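(* Let $\mathbb{F}$ be a field of characteristic not two and let $\alpha,\beta,\gamma,\psi\in\mathbb{F}$ be arbitrary. The algebra $A(\alpha,\beta,\gamma,\psi)$ is an axial algebra of Jordan type half generated by the three primitive idempotents (primitive axes) $e_1$, $e_2$, $e_3$.
   Context: Algebras are not assumed associative. Definition of $A(\alpha,\beta,\gamma,\psi)$: it is the commutative $\mathbb{F}$-algebra on a 9-dimensional $\mathbb{F}$-vector space with basis $e_1,\dots,e_9$, which are denoted respectively by the symbols $a,\ b,\ c,\ ab,\ bc,\ ac,\ a(bc),\ b(ac),\ c(ab)$ (as symbols, $xy$ and $yx$ are identified, and $x(yz)$ and $x(zy)$ are identified). Put $\lambda_{ab}=\lambda_{ba}=\alpha$, $\lambda_{bc}=\lambda_{cb}=\beta$, $\lambda_{ac}=\lambda_{ca}=\gamma$. The (commutative, bilinear) product $\cdot$ is given by the following formulas for every permutation $(x,y,z)$ of $(a,b,c)$: (1) $x\cdot x=x$, $\ x\cdot y=xy$, $\ x\cdot yz=x(yz)$; (2) $x\cdot xy=\frac12(\lambda_{xy}x+xy)$; (3) $x\cdot x(yz)=\frac12(\psi x+x(yz))$; (4) $x\cdot y(xz)=\frac14(\psi x+\lambda_{xz}\,xy+\lambda_{xy}\,xz+x(yz)+y(xz)-z(xy))$; (5) $xy\cdot xy=\frac{\lambda_{xy}}{4}(x+y)+\frac{\lambda_{xy}}{2}xy$; (6) $xy\cdot xz=\frac14(\psi x+\lambda_{xz}\,xy+\lambda_{xy}\,xz-x(yz)+y(xz)+z(xy))$; (7) $xy\cdot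 x(yz)=\frac18((\lambda_{xy}\lambda_{yz}+\psi)x+\psi y+2\psi\,xy+\lambda_{xy}\,yz+2\lambda_{xy}\,x(yz))$; (8) $xy\cdot z(xy)=\frac18(\lambda_{xy}\lambda_{yz}x+\lambda_{xy}\lambda_{xz}y+4\psi\,xy+\lambda_{xy}\,yz+\lambda_{xy}\,xz-2\lambda_{xy}\,x(yz)-2\lambda_{xy}\,y(xz)+4\lambda_{xy}\,z(xy))$; (9) $(x(yz))^2=\frac1{16}(\lambda_{yz}(\lambda_{xy}+\lambda_{xz}+2\psi)x+\lambda_{yz}\lambda_{xz}y+\lambda_{yz}\lambda_{xy}z+4\psi\,yz+(2\lambda_{yz}+8\psi)\,x(yz)-2\lambda_{yz}\,y(xz)-2\lambda_{yz}\,z(xy))$; (10) $x(yz)\cdot y(xz)=\frac1{16}(\lambda_{yz}(\lambda_{xz}+\psi)x+\lambda_{xz}(\lambda_{yz}+\psi)y+\lambda_{xy}\psi z+2\psi\,xy+2(\lambda_{xy}\lambda_{xz}+\psi)yz+2(\lambda_{xy}\lambda_{yz}+\psi)xz+(4\psi-\lambda_{xy}+\lambda_{yz}-\lambda_{xz})x(yz)+(4\psi-\lambda_{xy}-\lambda_{yz}+\lambda_{xz})y(xz)+(\lambda_{xy}-\lambda_{yz}-\lambda_{xz}-4\psi)z(xy))$. Axial algebras: for a commutative $\mathbb{F}$-algebra $A$, $u\in A$ and $\lambda\in\mathbb{F}$, let $ad_u: x\mapsto xu$ and let $A_\lambda(u)$ be the $\lambda$-eigenspace of $ad_u$ (possibly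 zero). $A$ is an axial algebra of Jordan type half if, with $\eta=\frac12$, it is generated (as an algebra) by a set $X$ of idempotents (called axes) such that for each $u\in X$: the minimal polynomial of $ad_u$ divides $(x-1)x(x-\eta)$, and $A_1(u)A_1(u)\subseteq A_1(u)$, $A_0(u)A_0(u)\subseteq A_0(u)$, $A_1(u)A_0(u)=\{0\}$, $(A_0(u)+A_1(u))A_\eta(u)\subseteq A_\eta(u)$, $A_\eta(u)A_\eta(u)\subseteq A_0(u)+A_1(u)$. An axis $u$ is primitive if $A_1(u)=\langle u\rangle$ is 1-dimensional. In the claim, $X=\{e_1,e_2,e_3\}$. *)

theory Defs
  imports "HOL-Analysis.Analysis" "HOL-Computational_Algebra.Polynomial"
begin

section \<open>Axial algebras of Jordan type\<close>

text \<open>Algebras are neither associative nor unital; the whole type is the carrier.\<close>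

locale comm_algebra = vector_space scale
  for scale :: "'f::field \<Rightarrow> 'v::ab_group_add \<Rightarrow> 'v" (infixr \<open>\<cdot>\<close> 75) +
  fixes mult :: "'v \<Rightarrow> 'v \<Rightarrow> 'v" (infixl \<open>\<odot>\<close> 70)
  assumes mult_commute: "x \<odot> y = y \<odot> x"
    and mult_add_left: "(x + y) \<odot> z = x \<odot> z + y \<odot> z"
    and mult_scale_left: "(k \<cdot> x) \<odot> y = k \<cdot> (x \<odot> y)"
begin

definition ad :: "'v \<Rightarrow> 'v \<Rightarrow> 'v" where
  "ad u x = x \<odot> u"

definition eigenspace :: "'f \<Rightarrow> 'v \<Rightarrow> 'v set" where
  "eigenspace l u = {x. ad u x = l \<cdot> x}"

definition poly_op :: "'f poly \<Rightarrow> ('v \<Rightarrow> 'v) \<Rightarrow> 'v \<Rightarrow> 'v" where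
  "poly_op p f x = (\<Sum>i\<le>degree p. coeff p i \<cdot> (f ^^ i) x)"

text \<open>A relation rather than a function, because in infinite dimension an operator need not
  have a minimal polynomial.\<close>

definition is_min_poly :: "('v \<Rightarrow> 'v) \<Rightarrow> 'f poly \<Rightarrow> bool" where
  "is_min_poly f p \<longleftrightarrow>
     lead_coeff p = 1 \<and> (\<forall>x. poly_op p f x = 0) \<and>
     (\<forall>q. q \<noteq> 0 \<and> (\<forall>x. poly_op q f x = 0) \<longrightarrow> degree p \<le> degree q)"

definition prod_space :: "'v set \<Rightarrow> 'v set \<Rightarrow> 'v set" (infixl \<open>\<odot>\<odot>\<close> 70) where
  "U \<odot>\<odot> V = span {x \<odot> y | x y. x \<in> U \<and> y \<in> V}"

definition subalgebra :: "'v set \<Rightarrow> bool" where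
  "subalgebra B \<longleftrightarrow> subspace B \<and> (\<forall>x\<in>B. \<forall>y\<in>B. x \<odot> y \<in> B)"

definition primitive :: "'v \<Rightarrow> bool" where
  "primitive u \<longleftrightarrow> eigenspace 1 u = span {u} \<and> dim (eigenspace 1 u) = 1"

end

text \<open>Sums of eigenspaces are elementwise sums of sets (\<^theory>\<open>HOL-Library.Set_Algebras\<close>).\<close>

locale jordan_type_axial_algebra = comm_algebra scale mult
  for scale :: "'f::field \<Rightarrow> 'v::ab_group_add \<Rightarrow> 'v" (infixr \<open>\<cdot>\<close> 75)
    and mult :: "'v \<Rightarrow> 'v \<Rightarrow> 'v" (infixl \<open>\<odot>\<close> 70) +
  fixes \<eta> :: 'f and X :: "'v set"
  assumes generated: "subalgebra hull X = UNIV"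
    and idempotent: "u \<in> X \<Longrightarrow> u \<odot> u = u"
    and min_poly: "u \<in> X \<Longrightarrow> \<exists>p. is_min_poly (ad u) p \<and> p dvd [:-1, 1:] * [:0, 1:] * [:-\<eta>, 1:]"
    and fusion_1_1: "u \<in> X \<Longrightarrow> eigenspace 1 u \<odot>\<odot> eigenspace 1 u \<subseteq> eigenspace 1 u"
    and fusion_0_0: "u \<in> X \<Longrightarrow> eigenspace 0 u \<odot>\<odot> eigenspace 0 u \<subseteq> eigenspace 0 u"
    and fusion_1_0: "u \<in> X \<Longrightarrow> eigenspace 1 u \<odot>\<odot> eigenspace 0 u = {0}"
    and fusion_01_eta: "u \<in> X \<Longrightarrow>
      (eigenspace 0 u + eigenspace 1 u) \<odot>\<odot> eigenspace \<eta> u \<subseteq> eigenspace \<eta> u"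
    and fusion_eta_eta: "u \<in> X \<Longrightarrow>
      eigenspace \<eta> u \<odot>\<odot> eigenspace \<eta> u \<subseteq> eigenspace 0 u + eigenspace 1 u"


section \<open>The nine-dimensional algebra\<close>

datatype gen = Ga | Gb | Gc

text \<open>With \<open>x, y, z\<close> the three generators in any order, \<open>G x\<close> is the symbol \<open>x\<close>,
  \<open>P z\<close> is the symbol \<open>xy = yx\<close> (indexed by the generator that does not occur), and
  \<open>T x\<close> is the symbol \<open>x(yz) = x(zy)\<close>.\<close>

datatype sym = G gen | P gen | T gen

lemma UNIV_gen: "UNIV = {Ga, Gb, Gc}"
  by (auto intro: gen.exhaust)

lemma UNIV_sym: "UNIV = range G \<union> range P \<union> range T"
proof (rule set_eqI)
  fix s
  show "s \<in> UNIV \<longleftrightarrow> s \<in> range G \<union> range P \<union> range T"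
    by (cases s) auto
qed

instance gen :: finite
  by standard (simp add: UNIV_gen)

instance sym :: finite
  by standard (simp add: UNIV_sym)

text \<open>For \<open>x \<noteq> y\<close>, the remaining generator; the value on equal arguments is irrelevant.\<close>

fun third :: "gen \<Rightarrow> gen \<Rightarrow> gen" where
  "third Ga Gb = Gc" | "third Gb Ga = Gc"
| "third Gb Gc = Ga" | "third Gc Gb = Ga"
| "third Ga Gc = Gb" | "third Gc Ga = Gb"
| "third x _ = x"

text \<open>An arbitrary pair of generators \<open>(y, z)\<close> completing \<open>x\<close>; used only where the formula is
  symmetric in \<open>y\<close> and \<open>z\<close>.\<close>

fun other1 :: "gen \<Rightarrow> gen" where
  "other1 Ga = Gb" | "other1 Gb = Gc" | "other1 Gc = Ga"

fun other2 :: "gen \<Rightarrow> gen" where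
  "other2 Ga = Gc" | "other2 Gb = Ga" | "other2 Gc = Gb"

abbreviation vG :: "gen \<Rightarrow> 'f::field ^ sym" where "vG x \<equiv> axis (G x) 1"
abbreviation vP :: "gen \<Rightarrow> gen \<Rightarrow> 'f::field ^ sym" where "vP x y \<equiv> axis (P (third x y)) 1"
abbreviation vT :: "gen \<Rightarrow> 'f::field ^ sym" where "vT x \<equiv> axis (T x) 1"

context
  fixes \<alpha> \<beta> \<gamma> \<psi> :: "'f::field"
begin

text \<open>\<open>lam\<close> depends on the unordered pair, that is, on the generator missing from it.\<close>

definition lam :: "gen \<Rightarrow> gen \<Rightarrow> 'f" where
  "lam x y = (case third x y of Gc \<Rightarrow> \<alpha> | Ga \<Rightarrow> \<beta> | Gb \<Rightarrow> \<gamma>)"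

definition prodGG :: "gen \<Rightarrow> gen \<Rightarrow> 'f ^ sym" where
  "prodGG x y = (if x = y then vG x else vP x y)"

definition prodGP :: "gen \<Rightarrow> gen \<Rightarrow> 'f ^ sym" where
  "prodGP x z =
     (if x = z then vT x
      else let y = third x z in (1/2) *s (lam x y *s vG x + vP x y))"

definition prodGT :: "gen \<Rightarrow> gen \<Rightarrow> 'f ^ sym" where
  "prodGT x y =
     (if x = y then (1/2) *s (\<psi> *s vG x + vT x)
      else let z = third x y in
        (1/4) *s (\<psi> *s vG x + lam x z *s vP x y + lam x y *s vP x z + vT x + vT y - vT z))"

definition prodPP :: "gen \<Rightarrow> gen \<Rightarrow> 'f ^ sym" where
  "prodPP z y =
     (if y = z then let x = other1 z; y = other2 z in
        (lam x y / 4) *s (vG x + vG y) + (lam x y / 2) *s vP x y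
      else let x = third y z in
        (1/4) *s (\<psi> *s vG x + lam x z *s vP x y + lam x y *s vP x z - vT x + vT y + vT z))"

definition prodPT :: "gen \<Rightarrow> gen \<Rightarrow> 'f ^ sym" where
  "prodPT z x =
     (if x = z then let x = other1 z; y = other2 z in
        (1/8) *s ((lam x y * lam y z) *s vG x + (lam x y * lam x z) *s vG y
          + (4 * \<psi>) *s vP x y + lam x y *s vP y z + lam x y *s vP x z
          - (2 * lam x y) *s vT x - (2 * lam x y) *s vT y + (4 * lam x y) *s vT z)
      else let y = third x z in
        (1/8) *s ((lam x y * lam y z + \<psi>) *s vG x + \<psi> *s vG y
          + (2 * \<psi>) *s vP x y + lam x y *s vP y z + (2 * lam x y) *s vT x))"

definition prodTT :: "gen \<Rightarrow> gen \<Rightarrow> 'f ^ sym" where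
  "prodTT x y =
     (if x = y then let y = other1 x; z = other2 x in
        (1/16) *s ((lam y z * (lam x y + lam x z + 2 * \<psi>)) *s vG x
          + (lam y z * lam x z) *s vG y + (lam y z * lam x y) *s vG z
          + (4 * \<psi>) *s vP y z + (2 * lam y z + 8 * \<psi>) *s vT x
          - (2 * lam y z) *s vT y - (2 * lam y z) *s vT z)
      else let z = third x y in
        (1/16) *s ((lam y z * (lam x z + \<psi>)) *s vG x + (lam x z * (lam y z + \<psi>)) *s vG y
          + (lam x y * \<psi>) *s vG z + (2 * \<psi>) *s vP x y
          + (2 * (lam x y * lam x z + \<psi>)) *s vP y z + (2 * (lam x y * lam y z + \<psi>)) *s vP x z
          + (4 * \<psi> - lam x y + lam y z - lam x z) *s vT x
          + (4 * \<psi> - lam x y - lam y z + lam x z) *s vT y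
          + (lam x y - lam y z - lam x z - 4 * \<psi>) *s vT z))"

fun basis_prod :: "sym \<Rightarrow> sym \<Rightarrow> 'f ^ sym" where
  "basis_prod (G x) (G y) = prodGG x y"
| "basis_prod (G x) (P y) = prodGP x y"
| "basis_prod (P x) (G y) = prodGP y x"
| "basis_prod (G x) (T y) = prodGT x y"
| "basis_prod (T x) (G y) = prodGT y x"
| "basis_prod (P x) (P y) = prodPP x y"
| "basis_prod (P x) (T y) = prodPT x y"
| "basis_prod (T x) (P y) = prodPT y x"
| "basis_prod (T x) (T y) = prodTT x y"

definition algA_mult :: "'f ^ sym \<Rightarrow> 'f ^ sym \<Rightarrow> 'f ^ sym" where
  "algA_mult p q = (\<Sum>s\<in>UNIV. \<Sum>r\<in>UNIV. (p $ s * q $ r) *s basis_prod s r)"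

lemma algA_mult_axis: "algA_mult (axis s 1) (axis r 1) = basis_prod s r"
proof -
  have "algA_mult (axis s 1) (axis r 1) =
      (\<Sum>s'\<in>UNIV. \<Sum>r'\<in>UNIV. if s' = s then if r' = r then basis_prod s' r' else 0 else 0)"
    unfolding algA_mult_def by (intro sum.cong refl) (simp add: axis_def)
  also have "\<dots> = (\<Sum>s'\<in>UNIV. if s' = s then basis_prod s' r else 0)"
    by (intro sum.cong refl) simp
  finally show ?thesis by simp
qed

lemma vP_commute: "x \<noteq> y \<Longrightarrow> vP x y = vP y x"
  by (cases x; cases y) auto

lemma lam_values: "lam Ga Gb = \<alpha>" "lam Gb Ga = \<alpha>" "lam Gb Gc = \<beta>" "lam Gc Gb = \<beta>"
  "lam Ga Gc = \<gamma>" "lam Gc Ga = \<gamma>"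
  by (simp_all add: lam_def)

text \<open>The defining relations, for every ordering \<open>x, y, z\<close> of the generators:\<close>

lemma algA_mult_relations:
  assumes "x \<noteq> y" "y \<noteq> z" "x \<noteq> z"
  shows
    "algA_mult (vG x) (vG x) = vG x"
    "algA_mult (vG x) (vG y) = vP x y"
    "algA_mult (vG x) (vP y z) = vT x"
    "algA_mult (vG x) (vP x y) = (1/2) *s (lam x y *s vG x + vP x y)"
    "algA_mult (vG x) (vT x) = (1/2) *s (\<psi> *s vG x + vT x)"
    "algA_mult (vG x) (vT y) =
       (1/4) *s (\<psi> *s vG x + lam x z *s vP x y + lam x y *s vP x z + vT x + vT y - vT z)"
    "algA_mult (vP x y) (vP x y) = (lam x y / 4) *s (vG x + vG y) + (lam x y / 2) *s vP x y"
    "algA_mult (vP x y) (vP x z) =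
       (1/4) *s (\<psi> *s vG x + lam x z *s vP x y + lam x y *s vP x z - vT x + vT y + vT z)"
    "algA_mult (vP x y) (vT x) =
       (1/8) *s ((lam x y * lam y z + \<psi>) *s vG x + \<psi> *s vG y
         + (2 * \<psi>) *s vP x y + lam x y *s vP y z + (2 * lam x y) *s vT x)"
    "algA_mult (vP x y) (vT z) =
       (1/8) *s ((lam x y * lam y z) *s vG x + (lam x y * lam x z) *s vG y
         + (4 * \<psi>) *s vP x y + lam x y *s vP y z + lam x y *s vP x z
         - (2 * lam x y) *s vT x - (2 * lam x y) *s vT y + (4 * lam x y) *s vT z)"
    "algA_mult (vT x) (vT x) =
       (1/16) *s ((lam y z * (lam x y + lam x z + 2 * \<psi>)) *s vG x
         + (lam y z * lam x z) *s vG y + (lam y z * lam x y) *s vG z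
         + (4 * \<psi>) *s vP y z + (2 * lam y z + 8 * \<psi>) *s vT x
         - (2 * lam y z) *s vT y - (2 * lam y z) *s vT z)"
    "algA_mult (vT x) (vT y) =
       (1/16) *s ((lam y z * (lam x z + \<psi>)) *s vG x + (lam x z * (lam y z + \<psi>)) *s vG y
         + (lam x y * \<psi>) *s vG z + (2 * \<psi>) *s vP x y
         + (2 * (lam x y * lam x z + \<psi>)) *s vP y z + (2 * (lam x y * lam y z + \<psi>)) *s vP x z
         + (4 * \<psi> - lam x y + lam y z - lam x z) *s vT x
         + (4 * \<psi> - lam x y - lam y z + lam x z) *s vT y
         + (lam x y - lam y z - lam x z - 4 * \<psi>) *s vT z)"
  using assms
  by (cases x; cases y; cases z;
      simp add: algA_mult_axis prodGG_def prodGP_def prodGT_def prodPP_def prodPT_def prodTT_def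
        lam_values Let_def algebra_simps)+

end

end

theory Submission
  imports Defs
begin

text \<open>Each eigenspace of \<open>ad x\<close> is cut out by linear equations in the coordinates whose
  coefficients are integer polynomials in the parameters; the equations \<open>half_free\<close> alone
  describe the sum of the 0- and 1-eigenspaces. Up to a common factor 16, so are the structure
  constants, and the fusion rules become polynomial identities over the integers. The generators
  enter in an arbitrary order \<open>x, y, z\<close>, so that one computation serves the three axes. The
  minimal polynomial is the full cubic: \<open>ad x - 1/2\<close> maps into the sum of the 0- and
  1-eigenspaces, and all three eigenvalues occur.\<close>

section \<open>The product is commutative and bilinear\<close>

lemma algA_comm_algebra: "comm_algebra (*s) (algA_mult \<alpha> \<beta> \<gamma> (\<psi>::'f::field))"
proof -
  have *: "basis_prod \<alpha> \<beta> \<gamma> \<psi> s r = basis_prod \<alpha> \<beta> \<gamma> \<psi> r s" for s r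
  proof -
    \<comment> \<open>Mixed products such as \<open>G\<close> with \<open>P\<close> use one function
      for both orders, so symmetry needs checking only within each of the three kinds of
      symbols.\<close>
    have "prodGG x y = (prodGG y x :: 'f ^ sym)"
      "prodPP \<alpha> \<beta> \<gamma> \<psi> x y = prodPP \<alpha> \<beta> \<gamma> \<psi> y x"
      "prodTT \<alpha> \<beta> \<gamma> \<psi> x y = prodTT \<alpha> \<beta> \<gamma> \<psi> y x" for x y
      by (cases x; cases y;
          simp add: prodGG_def prodPP_def prodTT_def lam_values Let_def algebra_simps)+
    then show ?thesis
      by (cases s; cases r) simp_all
  qed
  show ?thesis
  proof
    show "algA_mult \<alpha> \<beta> \<gamma> \<psi> p q = algA_mult \<alpha> \<beta> \<gamma> \<psi> q p" for p q
      unfolding algA_mult_def by (subst sum.swap) (simp add: * mult.commute)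
    show "algA_mult \<alpha> \<beta> \<gamma> \<psi> (p + p') q = algA_mult \<alpha> \<beta> \<gamma> \<psi> p q + algA_mult \<alpha> \<beta> \<gamma> \<psi> p' q"
      for p p' q
      unfolding algA_mult_def by (simp add: distrib_right vec.scale_left_distrib sum.distrib)
    show "algA_mult \<alpha> \<beta> \<gamma> \<psi> (k *s p) q = k *s algA_mult \<alpha> \<beta> \<gamma> \<psi> p q" for k p q
      unfolding algA_mult_def
      by (simp add: vec.scale_sum_right vec.scale_scale mult.assoc)
  qed
qed

section \<open>Eigenspaces and polynomials of operators in a commutative algebra\<close>

context comm_algebra
begin

lemma subspace_eigenspace: "subspace (eigenspace l u)"
  by (rule subspaceI)
    (auto simp: eigenspace_def ad_def mult_add_left mult_scale_left scale_right_distrib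
      mult.commute, metis add_cancel_left_left mult_add_left)

lemma prod_space_subset:
  assumes "\<And>v w. v \<in> U \<Longrightarrow> w \<in> V \<Longrightarrow> v \<odot> w \<in> W" "subspace W"
  shows "U \<odot>\<odot> V \<subseteq> W"
  unfolding prod_space_def using assms by (intro span_minimal) auto

text \<open>Makes every eigenvalue of \<open>ad u\<close> a root of every polynomial that
  annihilates \<open>ad u\<close>, which bounds the degree of the minimal polynomial from
  below.\<close>

lemma poly_op_eigenvector:
  assumes "v \<in> eigenspace l u"
  shows "poly_op q (ad u) v = poly q l \<cdot> v"
proof -
  have ad_scale: "ad u (k \<cdot> w) = k \<cdot> ad u w" for k w
    by (simp add: ad_def mult_scale_left)
  have "(ad u ^^ i) v = l ^ i \<cdot> v" for i
    using assms by (induction i) (simp_all add: eigenspace_def ad_scale mult.commute)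
  then show ?thesis
    by (simp add: poly_op_def poly_altdef scale_sum_left)
qed

end

section \<open>Coordinates along an ordered triple of generators\<close>

locale algA_axis =
  fixes \<alpha> \<beta> \<gamma> \<psi> :: "'f::field" and x y z :: gen
  assumes distinct: "x \<noteq> y" "y \<noteq> z" "x \<noteq> z"
    and two_nonzero: "(2::'f) \<noteq> 0"
begin

abbreviation mul :: "'f ^ sym \<Rightarrow> 'f ^ sym \<Rightarrow> 'f ^ sym" (infixl \<open>\<bullet>\<close> 70)
  where "p \<bullet> q \<equiv> algA_mult \<alpha> \<beta> \<gamma> \<psi> p q"
abbreviation "bprod \<equiv> basis_prod \<alpha> \<beta> \<gamma> \<psi>"
abbreviation "lxy \<equiv> lam \<alpha> \<beta> \<gamma> x y"
abbreviation "lxz \<equiv> lam \<alpha> \<beta> \<gamma> x z"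
abbreviation "lyz \<equiv> lam \<alpha> \<beta> \<gamma> y z"

sublocale comm_algebra "(*s)" "algA_mult \<alpha> \<beta> \<gamma> \<psi>"
  by (rule algA_comm_algebra)

lemma nonzero: "(4::'f) \<noteq> 0" "(8::'f) \<noteq> 0" "(16::'f) \<noteq> 0"
proof -
  have "(4::'f) = 2 * 2" "(8::'f) = 2 * 2 * 2" "(16::'f) = 2 * 2 * 2 * 2" by simp_all
  then show "(4::'f) \<noteq> 0" "(8::'f) \<noteq> 0" "(16::'f) \<noteq> 0"
    using two_nonzero by (metis no_zero_divisors)+
qed

lemma third_xyz [simp]: "third x y = z" "third y x = z" "third y z = x" "third z y = x"
  "third x z = y" "third z x = y"
  using distinct by (cases x; cases y; cases z; simp)+

lemma distinct_xyz [simp]: "x \<noteq> y" "y \<noteq> z" "x \<noteq> z" "y \<noteq> x" "z \<noteq> y" "z \<noteq> x"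
  using distinct by auto

lemma lam_commute: "lam \<alpha> \<beta> \<gamma> y x = lxy" "lam \<alpha> \<beta> \<gamma> z x = lxz" "lam \<alpha> \<beta> \<gamma> z y = lyz"
  by (simp_all add: lam_def)

lemma UNIV_sym_xyz: "UNIV = {G x, G y, G z, P x, P y, P z, T x, T y, T z}"
proof -
  have "g = x \<or> g = y \<or> g = z" for g
    using distinct by (cases x; cases y; cases z; cases g; simp)
  then have "s \<in> {G x, G y, G z, P x, P y, P z, T x, T y, T z}" for s
    by (cases s) auto
  then show ?thesis by blast
qed

lemma sum_sym: "sum f UNIV = f (G x) + f (G y) + f (G z) + f (P x) + f (P y) + f (P z)
    + f (T x) + f (T y) + f (T z)" for f :: "sym \<Rightarrow> 'b::comm_monoid_add"
  unfolding UNIV_sym_xyz by (simp add: ac_simps)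

lemma all_sym: "(\<forall>s. Q s) \<longleftrightarrow> Q (G x) \<and> Q (G y) \<and> Q (G z) \<and> Q (P x) \<and> Q (P y) \<and> Q (P z)
    \<and> Q (T x) \<and> Q (T y) \<and> Q (T z)"
proof -
  have "(\<forall>s. Q s) \<longleftrightarrow> (\<forall>s\<in>UNIV. Q s)" by simp
  then show ?thesis unfolding UNIV_sym_xyz by simp
qed

section \<open>The multiplication table in terms of \<open>x\<close>, \<open>y\<close>,
  \<open>z\<close>\<close>

lemmas relations_perms =
  algA_mult_relations[of x y z \<alpha> \<beta> \<gamma> \<psi>] algA_mult_relations[of x z y \<alpha> \<beta> \<gamma> \<psi>]
  algA_mult_relations[of y x z \<alpha> \<beta> \<gamma> \<psi>] algA_mult_relations[of y z x \<alpha> \<beta> \<gamma> \<psi>]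
  algA_mult_relations[of z x y \<alpha> \<beta> \<gamma> \<psi>] algA_mult_relations[of z y x \<alpha> \<beta> \<gamma> \<psi>]

lemmas bprod_half_table =
  relations_perms[simplified algA_mult_axis third_xyz lam_commute distinct_xyz simp_thms]

lemma bprod_commute: "bprod s r = bprod r s"
  using mult_commute[of "axis s 1" "axis r 1"] by (simp add: algA_mult_axis)

text \<open>The relations list mixed products only with \<open>G\<close> before \<open>P\<close>
  before \<open>T\<close>; the rewritten copy supplies the opposite orders. Each commutation rule
  used relates two different kinds of symbols, so unfolding it terminates.\<close>

lemmas bprod_table = bprod_half_table
  bprod_half_table[unfolded bprod_commute[of "G a" "P b" for a b]
    bprod_commute[of "G a" "T b" for a b] bprod_commute[of "P a" "T b" for a b]]

text \<open>Clears all denominators of the table: afterwards an identity between products needs only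
  ring normalisation and no division by powers of 2.\<close>

lemma scale16:
  "16 *s ((1/2) *s v) = 8 *s v" "16 *s ((1/4) *s v) = 4 *s v" "16 *s ((1/8) *s v) = 2 *s v"
  "16 *s ((1/16) *s v) = v" "16 *s ((a/4) *s v + (a/2) *s w) = (4 * a) *s v + (8 * a) *s w"
  for v w :: "'f ^ sym"
proof -
  have *: "16 * a / 4 = 4 * a" "16 * a / 2 = 8 * a" for a :: 'f
    using two_nonzero nonzero by (simp_all add: divide_eq_eq)
  show "16 *s ((a/4) *s v + (a/2) *s w) = (4 * a) *s v + (8 * a) *s w"
    by (simp add: * vec.scale_scale vec.scale_right_distrib)
qed (use two_nonzero nonzero in \<open>simp_all add: vec.scale_scale divide_eq_eq\<close>)

lemmas bprod_table16 = bprod_table[THEN arg_cong[of _ _ "(*s) 16"], unfolded scale16]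

lemma mul_component16:
  "(16 *s (p \<bullet> q)) $ k = (\<Sum>s\<in>UNIV. \<Sum>r\<in>UNIV. p $ s * q $ r * ((16 *s bprod s r) $ k))"
  by (simp add: algA_mult_def sum_distrib_left algebra_simps)

lemma mul_component: "(p \<bullet> q) $ k = (\<Sum>s\<in>UNIV. \<Sum>r\<in>UNIV. p $ s * q $ r * (bprod s r $ k))"
  by (simp add: algA_mult_def)

section \<open>The matrix of \<open>ad x\<close>\<close>

lemma ad_component:
  "ad (vG x) v $ G x =
     v $ G x + lxy/2 * v $ P z + lxz/2 * v $ P y + \<psi>/2 * v $ T x + \<psi>/4 * (v $ T y + v $ T z)"
  "ad (vG x) v $ G y = 0"
  "ad (vG x) v $ G z = 0"
  "ad (vG x) v $ P x = 0"
  "ad (vG x) v $ P y = v $ G z + v $ P y / 2 + lxy/4 * (v $ T y + v $ T z)"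
  "ad (vG x) v $ P z = v $ G y + v $ P z / 2 + lxz/4 * (v $ T y + v $ T z)"
  "ad (vG x) v $ T x = v $ P x + v $ T x / 2 + (v $ T y + v $ T z) / 4"
  "ad (vG x) v $ T y = (v $ T y - v $ T z) / 4"
  "ad (vG x) v $ T z = (v $ T z - v $ T y) / 4"
  by (simp_all add: ad_def mul_component sum_sym bprod_table axis_def algebra_simps
      add_divide_distrib diff_divide_distrib del: basis_prod.simps)

lemma scale4: "4 * a / 2 = 2 * a" "4 * a / 4 = a" for a :: 'f
  using two_nonzero nonzero by (simp_all add: divide_eq_eq)

lemma ad_component4:
  "4 * ad (vG x) v $ G x =
     4 * v $ G x + 2 * lxy * v $ P z + 2 * lxz * v $ P y + 2 * \<psi> * v $ T x
       + \<psi> * (v $ T y + v $ T z)"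
  "4 * ad (vG x) v $ P y = 4 * v $ G z + 2 * v $ P y + lxy * (v $ T y + v $ T z)"
  "4 * ad (vG x) v $ P z = 4 * v $ G y + 2 * v $ P z + lxz * (v $ T y + v $ T z)"
  "4 * ad (vG x) v $ T x = 4 * v $ P x + 2 * v $ T x + (v $ T y + v $ T z)"
  "4 * ad (vG x) v $ T y = v $ T y - v $ T z"
  "4 * ad (vG x) v $ T z = v $ T z - v $ T y"
  unfolding ad_component distrib_left[of 4] right_diff_distrib[of 4] times_divide_eq_left
    times_divide_eq_right
  by (simp_all only: scale4[where a = "b * c" for b c] scale4 mult.assoc add_divide_distrib
      diff_divide_distrib)

section \<open>Linear equations for the eigenspaces of \<open>ad x\<close>\<close>

definition half_free :: "'f ^ sym \<Rightarrow> bool" where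
  "half_free v \<longleftrightarrow> v $ T z = v $ T y
     \<and> v $ P z = - 2 * v $ G y - lxz * v $ T y
     \<and> v $ P y = - 2 * v $ G z - lxy * v $ T y
     \<and> v $ T x = - 2 * v $ P x - v $ T y"

text \<open>For a vector satisfying \<open>half_free\<close>, the difference of the two sides is the
  coefficient of its 1-component, a multiple of \<open>x\<close>. As in the other two conditions,
  the equation expresses a dependent coordinate through free ones, so it serves as a rewrite
  rule.\<close>

definition x_free :: "'f ^ sym \<Rightarrow> bool" where
  "x_free v \<longleftrightarrow> v $ G x = lxy * v $ G y + lxz * v $ G z + lxy * lxz * v $ T y + \<psi> * v $ P x"

definition pure_half :: "'f ^ sym \<Rightarrow> bool" where
  "pure_half v \<longleftrightarrow> v $ G y = 0 \<and> v $ G z = 0 \<and> v $ P x = 0 \<and> v $ T z = - v $ T y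
     \<and> v $ G x = - (lxy * v $ P z + lxz * v $ P y + \<psi> * v $ T x)"

section \<open>The fusion rules as polynomial identities\<close>

lemma half_free_mul_0_0:
  assumes "half_free p" "x_free p" "half_free q" "x_free q"
  shows "half_free (16 *s (p \<bullet> q))"
  using assms unfolding half_free_def x_free_def mul_component16 sum_sym
  \<comment> \<open>The first simplification inserts the table and eliminates the dependent
    coordinates of \<open>p\<close> and \<open>q\<close> by the assumed equations; what remains is
    an identity in a commutative ring, left to the second.\<close>
  by (intro conjI;
      simp add: bprod_table16 axis_def del: basis_prod.simps; simp add: algebra_simps)

lemma x_free_mul_0_0:
  assumes "half_free p" "x_free p" "half_free q" "x_free q"
  shows "x_free (16 *s (p \<bullet> q))"
  using assms unfolding half_free_def x_free_def mul_component16 sum_sym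
  by (simp add: bprod_table16 axis_def del: basis_prod.simps; simp add: algebra_simps)

lemma pure_half_mul_0_half:
  assumes "half_free p" "x_free p" "pure_half q"
  shows "pure_half (16 *s (p \<bullet> q))"
  using assms unfolding half_free_def x_free_def pure_half_def mul_component16 sum_sym
  by (intro conjI;
      simp add: bprod_table16 axis_def del: basis_prod.simps; simp add: algebra_simps)

lemma half_free_mul_half_half:
  assumes "pure_half p" "pure_half q"
  shows "half_free (16 *s (p \<bullet> q))"
  using assms unfolding half_free_def pure_half_def mul_component16 sum_sym
  by (intro conjI;
      simp add: bprod_table16 axis_def del: basis_prod.simps; simp add: algebra_simps)

section \<open>The three eigenspaces\<close>

lemma eigenspace_iff:
  "v \<in> eigenspace l (vG x) \<longleftrightarrow> (\<forall>s. ad (vG x) v $ s = l * v $ s)"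
  by (simp only: eigenspace_def mem_Collect_eq vec_eq_iff vector_smult_component)

lemma eigenspace_0: "eigenspace 0 (vG x) = {v. half_free v \<and> x_free v}"
proof -
  have "v \<in> eigenspace 0 (vG x) \<longleftrightarrow> half_free v \<and> x_free v" for v
  proof
    assume "v \<in> eigenspace 0 (vG x)"
    then have eq: "ad (vG x) v $ s = 0" for s
      by (simp add: eigenspace_iff)
    have Tz: "v $ T z = v $ T y"
      using eq[of "T z", unfolded ad_component] nonzero by simp
    have halves: "a / 4 * (b + b) = a * b / 2" "(b + b) / 4 = b / 2" for a b :: 'f
      using two_nonzero nonzero by (simp_all add: field_simps)
    \<comment> \<open>Once the \<open>T y\<close> and \<open>T z\<close> coordinates agree, the rows
      \<open>P y\<close>, \<open>P z\<close> and \<open>T x\<close> all take this shape.\<close>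
    have solve: "b = - 2 * a - c" if "a + b / 2 + c / 2 = 0" for a b c :: 'f
    proof -
      have "b + (2 * a + c) = 2 * (a + b / 2 + c / 2)"
        using two_nonzero by (simp add: distrib_left)
      then show ?thesis
        using that eq_neg_iff_add_eq_0[of b "2 * a + c"] by simp
    qed
    have PT: "v $ P y = - 2 * v $ G z - lxy * v $ T y" "v $ P z = - 2 * v $ G y - lxz * v $ T y"
      "v $ T x = - 2 * v $ P x - v $ T y"
      by (rule eq[of "P y", unfolded ad_component Tz halves, THEN solve]
          eq[of "P z", unfolded ad_component Tz halves, THEN solve]
          eq[of "T x", unfolded ad_component Tz halves, THEN solve])+
    moreover have "x_free v"
    proof -
      have "2 * (v $ G x + lxy/2 * v $ P z + lxz/2 * v $ P y + \<psi>/2 * v $ T x + \<psi> * v $ T y / 2) = 0"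
        using eq[of "G x", unfolded ad_component Tz halves] by simp
      then have "2 * v $ G x + lxy * v $ P z + lxz * v $ P y + \<psi> * v $ T x + \<psi> * v $ T y = 0"
        using two_nonzero by (simp add: distrib_left)
      \<comment> \<open>Substituting \<open>PT\<close> cancels the terms in \<psi> and
        \<open>T y\<close>, and the two copies of \<open>lxy * lxz * v $ T y\<close> combine, so the
        factor 2 can be divided out.\<close>
      then have "2 * v $ G x
          = 2 * (lxy * v $ G y + lxz * v $ G z + lxy * lxz * v $ T y + \<psi> * v $ P x)"
        unfolding PT by (simp add: algebra_simps)
      then show ?thesis
        using two_nonzero unfolding x_free_def by (metis mult_left_cancel)
    qed
    ultimately show "half_free v \<and> x_free v"
      using Tz by (simp add: half_free_def)
  next
    assume "half_free v \<and> x_free v"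
    \<comment> \<open>The converse is verified on four times the matrix, which has no
      denominators.\<close>
    then have "\<forall>s. 4 * ad (vG x) v $ s = 0"
      unfolding all_sym ad_component4 half_free_def x_free_def
      by (simp add: ad_component; simp add: algebra_simps)
    then have "\<forall>s. ad (vG x) v $ s = 0"
      using nonzero(1) by simp
    then show "v \<in> eigenspace 0 (vG x)"
      by (simp add: eigenspace_iff)
  qed
  then show ?thesis by blast
qed

lemma eigenspace_half: "eigenspace (1/2) (vG x) = {v. pure_half v}"
proof -
  have "v \<in> eigenspace (1/2) (vG x) \<longleftrightarrow> pure_half v" for v
  proof
    assume "v \<in> eigenspace (1/2) (vG x)"
    then have eq: "ad (vG x) v $ s = v $ s / 2" for s
      by (simp add: eigenspace_iff)
    have "v $ T y - v $ T z = 4 * ((v $ T y - v $ T z) / 4)"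
      using nonzero(1) by simp
    also have "\<dots> = 4 * (v $ T y / 2)"
      unfolding eq[of "T y", unfolded ad_component] ..
    also have "\<dots> = 2 * v $ T y"
      using two_nonzero by (simp add: divide_eq_eq)
    finally have "v $ T y - v $ T z = 2 * v $ T y" .
    then have Tz: "v $ T z = - v $ T y"
      by algebra
    have zero: "v $ G y = 0" "v $ G z = 0" "v $ P x = 0"
      using eq[of "G y"] eq[of "G z"] eq[of "P x"] two_nonzero by (simp_all add: ad_component)
    have "4 * ad (vG x) v $ G x = 2 * v $ G x"
      unfolding eq using two_nonzero by (simp add: divide_eq_eq)
    \<comment> \<open>With \<open>Tz\<close> the sum of the \<open>T y\<close> and
      \<open>T z\<close> coordinates drops out of the \<open>G x\<close> row.\<close>
    then have "2 * (v $ G x + (lxy * v $ P z + lxz * v $ P y + \<psi> * v $ T x)) = 2 * 0"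
      unfolding ad_component4 Tz by algebra
    then have "v $ G x = - (lxy * v $ P z + lxz * v $ P y + \<psi> * v $ T x)"
      using two_nonzero by (simp only: mult_cancel_left simp_thms eq_neg_iff_add_eq_0)
    then show "pure_half v"
      using Tz zero by (simp add: pure_half_def)
  next
    assume "pure_half v"
    then have "\<forall>s. 4 * ad (vG x) v $ s = 2 * v $ s"
      unfolding all_sym ad_component4 pure_half_def
      by (simp add: ad_component; simp add: algebra_simps)
    moreover have "2 * a = 4 * (a / 2)" for a :: 'f
      using two_nonzero by (simp add: divide_eq_eq)
    ultimately have "\<forall>s. ad (vG x) v $ s = v $ s / 2"
      using nonzero(1) by (simp only: mult_cancel_left simp_thms)
    then show "v \<in> eigenspace (1/2) (vG x)"
      by (simp add: eigenspace_iff)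
  qed
  then show ?thesis by blast
qed

lemma eigenspace_1: "eigenspace 1 (vG x) = vec.span {vG x}"
proof
  show "eigenspace 1 (vG x) \<subseteq> vec.span {vG x}"
  proof
    fix v assume "v \<in> eigenspace 1 (vG x)"
    then have eq: "ad (vG x) v $ s = v $ s" for s
      by (simp add: eigenspace_iff)
    have zero: "v $ G y = 0" "v $ G z = 0" "v $ P x = 0"
      using eq[of "G y"] eq[of "G z"] eq[of "P x"] by (simp_all add: ad_component)
    have T4: "v $ T y - v $ T z = v $ T y * 4" "v $ T z - v $ T y = v $ T z * 4"
      using eq[of "T y", unfolded ad_component] eq[of "T z", unfolded ad_component] nonzero(1)
      by (simp_all only: divide_eq_eq if_True not_False_eq_True)
    \<comment> \<open>Adding the two rows cancels their left-hand sides; the resulting relation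
      turns the first row into \<open>2 * v $ T y = 0\<close>. Only powers of 2 are divided out, so
      characteristic 3 needs no separate treatment.\<close>
    have "(v $ T z + v $ T y) * 4 = (v $ T z - v $ T y) + (v $ T y - v $ T z)"
      unfolding T4 by (simp add: distrib_right)
    then have "(v $ T z + v $ T y) * 4 = 0"
      by simp
    then have sum: "v $ T z = - v $ T y"
      using nonzero(1) by (simp only: mult_eq_0_iff simp_thms eq_neg_iff_add_eq_0)
    have "2 * v $ T y = 0"
      using T4(1) unfolding sum by algebra
    then have T: "v $ T y = 0" "v $ T z = 0"
      using two_nonzero sum by simp_all
    \<comment> \<open>Thus 1/2 differs from 1, and the rows \<open>P y\<close>, \<open>P z\<close>
      and \<open>T x\<close>, now of the form \<open>a / 2 = a\<close>, force these coordinates to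
      vanish.\<close>
    have "(2::'f) \<noteq> 1"
      by (metis one_add_one add_cancel_left_left one_neq_zero)
    then have half: "a = 0" if "a / 2 = a" for a :: 'f
      using that two_nonzero by (simp add: divide_eq_eq)
    note zeros = add_0_left add_0_right mult_zero_right div_0
    have "v $ P y = 0" "v $ P z = 0" "v $ T x = 0"
      by (rule eq[of "P y", unfolded ad_component zero T zeros, THEN half]
          eq[of "P z", unfolded ad_component zero T zeros, THEN half]
          eq[of "T x", unfolded ad_component zero T zeros, THEN half])+
    then have "\<forall>s. v $ s = (v $ G x *s vG x) $ s"
      using zero T unfolding all_sym by (simp add: axis_def)
    then have "v = v $ G x *s vG x"
      by (rule iffD2[OF vec_eq_iff])
    then show "v \<in> vec.span {vG x}"
      by (metis vec.span_base vec.span_scale singletonI)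
  qed
  have "vG x \<in> eigenspace 1 (vG x)"
    using relations_perms(1) by (simp add: eigenspace_def ad_def)
  then show "vec.span {vG x} \<subseteq> eigenspace 1 (vG x)"
    by (intro vec.span_minimal subspace_eigenspace) simp
qed

text \<open>The conditions of \<open>half_free\<close> do not involve the coordinate
  \<open>G x\<close>, so adding multiples of \<open>x\<close> preserves them, and one suitable
  multiple achieves \<open>x_free\<close>.\<close>

lemma eigenspace_0_plus_1: "eigenspace 0 (vG x) + eigenspace 1 (vG x) = {v. half_free v}"
proof (intro equalityI subsetI)
  fix v assume "v \<in> eigenspace 0 (vG x) + eigenspace 1 (vG x)"
  then obtain v0 k where "v = v0 + k *s vG x" "half_free v0"
    by (auto simp: set_plus_def eigenspace_0 eigenspace_1 vec.span_singleton)
  then show "v \<in> {v. half_free v}"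
    by (simp add: half_free_def axis_def)
next
  fix v assume v: "v \<in> {v. half_free v}"
  define k where "k = v $ G x - (lxy * v $ G y + lxz * v $ G z + lxy * lxz * v $ T y + \<psi> * v $ P x)"
  have "v - k *s vG x \<in> eigenspace 0 (vG x)"
    unfolding eigenspace_0 mem_Collect_eq
    using v by (simp add: half_free_def x_free_def axis_def k_def)
  moreover have "k *s vG x \<in> eigenspace 1 (vG x)"
    by (simp add: eigenspace_1 vec.span_base vec.span_scale)
  moreover have "v = (v - k *s vG x) + k *s vG x"
    by simp
  ultimately show "v \<in> eigenspace 0 (vG x) + eigenspace 1 (vG x)"
    by (metis set_plus_intro)
qed

section \<open>The fusion rules for the eigenspaces\<close>

lemma subspace_half_free: "vec.subspace {v. half_free v}"
  by (rule vec.subspaceI; simp add: half_free_def; simp add: algebra_simps)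

text \<open>Returns from the identities for sixteen times a product to the product itself.\<close>

lemma subspace_scale16D:
  fixes v :: "'f ^ 'n"
  assumes "vec.subspace S" "16 *s v \<in> S"
  shows "v \<in> S"
proof -
  have "(1/16) *s (16 *s v) \<in> S"
    using assms by (rule vec.subspace_scale)
  then show ?thesis
    using nonzero by (simp add: vec.scale_scale)
qed

lemma mul_0_0:
  assumes "v \<in> eigenspace 0 (vG x)" "w \<in> eigenspace 0 (vG x)"
  shows "v \<bullet> w \<in> eigenspace 0 (vG x)"
  by (rule subspace_scale16D[OF subspace_eigenspace])
    (use assms half_free_mul_0_0 x_free_mul_0_0 in \<open>auto simp: eigenspace_0\<close>)

lemma mul_0_half:
  assumes "v \<in> eigenspace 0 (vG x)" "w \<in> eigenspace (1/2) (vG x)"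
  shows "v \<bullet> w \<in> eigenspace (1/2) (vG x)"
  by (rule subspace_scale16D[OF subspace_eigenspace])
    (use assms pure_half_mul_0_half in \<open>auto simp: eigenspace_0 eigenspace_half\<close>)

lemma mul_half_half:
  assumes "v \<in> eigenspace (1/2) (vG x)" "w \<in> eigenspace (1/2) (vG x)"
  shows "v \<bullet> w \<in> {v. half_free v}"
  by (rule subspace_scale16D[OF subspace_half_free])
    (use assms half_free_mul_half_half in \<open>auto simp: eigenspace_half\<close>)

text \<open>The 1-eigenspace is the line through \<open>x\<close>, so its elements act on
  \<open>w\<close> as multiples of \<open>ad x\<close>. This yields every fusion rule involving the
  eigenvalue 1; for \<open>l = 0\<close> the span is zero.\<close>

lemma mul_1_eigenspace:
  assumes "v \<in> eigenspace 1 (vG x)" "w \<in> eigenspace l (vG x)"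
  shows "v \<bullet> w \<in> vec.span {l *s w}"
proof -
  obtain k where "v = k *s vG x"
    using assms(1) unfolding eigenspace_1 vec.span_singleton by blast
  moreover have "w \<bullet> vG x = l *s w"
    using assms(2) by (simp add: eigenspace_def ad_def)
  ultimately have "v \<bullet> w = k *s (l *s w)"
    by (metis mult_scale_left mult_commute)
  then show ?thesis
    by (metis vec.span_base vec.span_scale singletonI)
qed

lemma mul_1_closed:
  assumes "v \<in> eigenspace 1 (vG x)" "w \<in> eigenspace l (vG x)"
  shows "v \<bullet> w \<in> eigenspace l (vG x)"
proof -
  have "vec.span {l *s w} \<subseteq> eigenspace l (vG x)"
    using assms(2) subspace_eigenspace by (intro vec.span_minimal) (auto intro: vec.subspace_scale)
  then show ?thesis using mul_1_eigenspace[OF assms] by blast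
qed

lemma fusion:
  "prod_space (eigenspace 1 (vG x)) (eigenspace 1 (vG x)) \<subseteq> eigenspace 1 (vG x)"
  "prod_space (eigenspace 0 (vG x)) (eigenspace 0 (vG x)) \<subseteq> eigenspace 0 (vG x)"
  "prod_space (eigenspace 1 (vG x)) (eigenspace 0 (vG x)) = {0}"
  "prod_space (eigenspace 0 (vG x) + eigenspace 1 (vG x)) (eigenspace (1/2) (vG x))
     \<subseteq> eigenspace (1/2) (vG x)"
  "prod_space (eigenspace (1/2) (vG x)) (eigenspace (1/2) (vG x))
     \<subseteq> eigenspace 0 (vG x) + eigenspace 1 (vG x)"
proof -
  show "prod_space (eigenspace 1 (vG x)) (eigenspace 1 (vG x)) \<subseteq> eigenspace 1 (vG x)"
    "prod_space (eigenspace 0 (vG x)) (eigenspace 0 (vG x)) \<subseteq> eigenspace 0 (vG x)"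
    by (intro prod_space_subset subspace_eigenspace mul_1_closed mul_0_0; assumption)+
  have "prod_space (eigenspace 1 (vG x)) (eigenspace 0 (vG x)) \<subseteq> {0}"
    using mul_1_eigenspace[of _ _ 0]
    by (intro prod_space_subset) (auto simp: vec.span_singleton)
  then show "prod_space (eigenspace 1 (vG x)) (eigenspace 0 (vG x)) = {0}"
    unfolding prod_space_def using vec.span_zero by blast
  show "prod_space (eigenspace 0 (vG x) + eigenspace 1 (vG x)) (eigenspace (1/2) (vG x))
     \<subseteq> eigenspace (1/2) (vG x)"
  proof (intro prod_space_subset subspace_eigenspace)
    fix v w assume "v \<in> eigenspace 0 (vG x) + eigenspace 1 (vG x)"
      and w: "w \<in> eigenspace (1/2) (vG x)"
    then obtain v0 v1 where v: "v = v0 + v1"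
      and "v0 \<in> eigenspace 0 (vG x)" "v1 \<in> eigenspace 1 (vG x)"
      by (auto elim: set_plus_elim)
    then have "v0 \<bullet> w + v1 \<bullet> w \<in> eigenspace (1/2) (vG x)"
      using w by (intro vec.subspace_add[OF subspace_eigenspace] mul_0_half mul_1_closed)
    then show "v \<bullet> w \<in> eigenspace (1/2) (vG x)"
      by (simp only: v mult_add_left)
  qed
  show "prod_space (eigenspace (1/2) (vG x)) (eigenspace (1/2) (vG x))
     \<subseteq> eigenspace 0 (vG x) + eigenspace 1 (vG x)"
    unfolding eigenspace_0_plus_1
    by (intro prod_space_subset subspace_half_free mul_half_half)
qed

section \<open>The minimal polynomial\<close>

lemma ad_min_poly: "is_min_poly (ad (vG x)) ([:-1, 1:] * [:0, 1:] * [:-(1/2), 1:])"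
proof -
  define m :: "'f poly" where "m = [:-1, 1:] * [:0, 1:] * [:-(1/2), 1:]"
  have m: "m = [:0, 1/2, - (1 + 1/2), 1:]"
    by (simp add: m_def)
  have annihilates: "poly_op m (ad (vG x)) v = 0" for v
  proof -
    define f where "f = ad (vG x)"
    have add: "f (p + q) = f p + f q" and scale: "f (k *s p) = k *s f p" for p q k
      by (simp_all add: f_def ad_def mult_add_left mult_scale_left)
    \<comment> \<open>This is \<open>ad x - 1/2\<close> applied to \<open>v\<close>, scaled by 4 to
      avoid denominators.\<close>
    define w where "w = 4 *s f v + (-2) *s v"
    have "half_free w"
      unfolding half_free_def w_def f_def vector_add_component vector_smult_component
        ad_component4
      by (simp add: ad_component; simp add: algebra_simps)
    then have "w \<in> eigenspace 0 (vG x) + eigenspace 1 (vG x)"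
      by (simp add: eigenspace_0_plus_1)
    then obtain w0 w1 where "w = w0 + w1" "f w0 = 0" "f w1 = w1"
      by (auto simp: eigenspace_def f_def elim!: set_plus_elim)
    \<comment> \<open>Both sides equal \<open>w1\<close>.\<close>
    then have "f (f w) = f w"
      by (simp add: add)
    then have "4 *s f (f (f v)) + (-2) *s f (f v) = 4 *s f (f v) + (-2) *s f v"
      by (simp only: w_def add scale)
    then have cubic: "4 * f (f (f v)) $ s = 6 * f (f v) $ s - 2 * f v $ s" for s
      by (simp add: vec_eq_iff algebra_simps)
    have "4 * poly_op m f v $ s = 0" for s
    proof -
      have "poly_op m f v $ s = f v $ s / 2 - (f (f v) $ s + f (f v) $ s / 2) + f (f (f v)) $ s"
        unfolding m poly_op_def by (simp add: numeral_eq_Suc)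
      then have "4 * poly_op m f v $ s
          = 2 * f v $ s - (4 * f (f v) $ s + 2 * f (f v) $ s) + 4 * f (f (f v)) $ s"
        by (simp only: distrib_left right_diff_distrib times_divide_eq_right scale4)
      then show ?thesis by (simp add: cubic)
    qed
    then show ?thesis using nonzero(1) by (simp add: vec_eq_iff f_def)
  qed
  have minimal: "3 \<le> degree q" if "q \<noteq> 0" "\<forall>v. poly_op q (ad (vG x)) v = 0" for q
  proof -
    have root: "poly q l = 0" if "v \<in> eigenspace l (vG x)" "v $ s = 1" for l v s
    proof -
      have "poly q l *s v = 0"
        using poly_op_eigenvector[OF that(1), of q] \<open>\<forall>v. _\<close> by simp
      then have "(poly q l *s v) $ s = 0"
        by (simp only: zero_index)
      then show ?thesis
        using that(2) by (simp only: vector_smult_component mult_1_right)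
    qed
    have "vG x \<in> eigenspace 1 (vG x)"
      by (simp add: eigenspace_1 vec.span_base)
    then have "poly q 1 = 0"
      by (rule root[of _ _ "G x"]) simp
    \<comment> \<open>This vector is the 0-component of \<open>y\<close>; the 1/2-eigenvector below
      is half of the 1/2-component of \<open>y\<close>, and the 1-component is
      \<open>lxy *s vG x\<close>. Each of the two vectors has a coordinate equal to 1, as
      \<open>root\<close> requires.\<close>
    moreover have "vG y - 2 *s vP x y + lxy *s vG x \<in> eigenspace 0 (vG x)"
      unfolding eigenspace_0 mem_Collect_eq by (simp add: half_free_def x_free_def axis_def)
    then have "poly q 0 = 0"
      by (rule root[of _ _ "G y"]) (simp add: axis_def)
    moreover have "vP x y - lxy *s vG x \<in> eigenspace (1/2) (vG x)"
      unfolding eigenspace_half mem_Collect_eq by (simp add: pure_half_def axis_def)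
    then have "poly q (1/2) = 0"
      by (rule root[of _ _ "P z"]) (simp add: axis_def)
    ultimately have "{0, 1, 1/2} \<subseteq> {l. poly q l = 0}"
      by simp
    then have "card {0, 1, 1/2 :: 'f} \<le> card {l. poly q l = 0}"
      by (rule card_mono[OF poly_roots_finite[OF \<open>q \<noteq> 0\<close>]])
    \<comment> \<open>Together with \<open>two_nonzero\<close> this makes 0, 1 and 1/2
      distinct.\<close>
    moreover have "(2::'f) \<noteq> 1"
      by (metis one_add_one add_cancel_left_left one_neq_zero)
    then have "card {0, 1, 1/2 :: 'f} = 3"
      using two_nonzero
      by (subst card_insert_disjoint) (simp_all add: divide_eq_eq eq_divide_eq)
    ultimately show ?thesis
      using card_poly_roots_bound[OF \<open>q \<noteq> 0\<close>] by linarith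
  qed
  have "lead_coeff m = 1" "degree m = 3"
    by (simp_all add: m)
  then show ?thesis
    unfolding m_def[symmetric] is_min_poly_def using annihilates minimal by auto
qed

section \<open>Primitivity and generation\<close>

lemma primitive_x: "primitive (vG x)"
proof -
  have "vG x \<noteq> (0 :: 'f ^ sym)"
    by (simp add: axis_eq_0_iff)
  then show ?thesis
    by (simp add: primitive_def eigenspace_1 vec.dim_span vec.dim_singleton)
qed

text \<open>Products of two generators give the symbols \<open>P\<close>; multiplying each by its
  missing generator gives the symbols \<open>T\<close>, which completes the basis.\<close>

lemma subalgebra_eq_UNIV:
  assumes "subalgebra B" "vG x \<in> B" "vG y \<in> B" "vG z \<in> B"
  shows "B = UNIV"
proof -
  have sub: "vec.subspace B" and closed: "\<And>p q. p \<in> B \<Longrightarrow> q \<in> B \<Longrightarrow> p \<bullet> q \<in> B"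
    using assms(1) by (auto simp: subalgebra_def)
  have P: "axis (P x) 1 \<in> B" "axis (P y) 1 \<in> B" "axis (P z) 1 \<in> B"
    using closed[OF assms(3,4)] closed[OF assms(2,4)] closed[OF assms(2,3)]
    by (simp_all add: algA_mult_axis bprod_table del: basis_prod.simps)
  have T: "axis (T x) 1 \<in> B" "axis (T y) 1 \<in> B" "axis (T z) 1 \<in> B"
    using closed[OF assms(2) P(1)] closed[OF assms(3) P(2)] closed[OF assms(4) P(3)]
    by (simp_all add: algA_mult_axis bprod_table del: basis_prod.simps)
  have "\<forall>s. axis s 1 \<in> B"
    unfolding all_sym using assms P T by simp
  then have "(\<Sum>s\<in>UNIV. v $ s *s axis s 1) \<in> B" for v
    by (intro vec.subspace_sum[OF sub] vec.subspace_scale[OF sub]) simp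
  then show ?thesis
    by (simp add: basis_expansion) blast
qed

end

theorem proposition3:
  fixes \<alpha> \<beta> \<gamma> \<psi> :: "'f::field"
  assumes "CHAR('f) \<noteq> 2"
  shows "jordan_type_axial_algebra (*s) (algA_mult \<alpha> \<beta> \<gamma> \<psi>) (1/2) {vG Ga, vG Gb, vG Gc}
    \<and> (\<forall>u\<in>{vG Ga, vG Gb, vG Gc}. comm_algebra.primitive (*s) (algA_mult \<alpha> \<beta> \<gamma> \<psi>) u)"
proof -
  interpret comm_algebra "(*s)" "algA_mult \<alpha> \<beta> \<gamma> \<psi>"
    by (rule algA_comm_algebra)
  have "(2::'f) \<noteq> 0"
  proof
    assume "(2::'f) = 0"
    then have "CHAR('f) dvd 2"
      using of_nat_eq_0_iff_char_dvd[where 'a = 'f, of 2] by simp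
    then show False
      \<comment> \<open>The characteristic is not 1, so dividing the prime 2 would force it to be
        2.\<close>
      using assms CHAR_not_1[where 'a = 'f] prime_nat_iff two_is_prime_nat by auto
  qed
  \<comment> \<open>The cyclic orderings put each generator once in the role of
    \<open>x\<close>.\<close>
  then have loc: "algA_axis TYPE('f) Ga Gb Gc"
    "algA_axis TYPE('f) Gb Gc Ga" "algA_axis TYPE('f) Gc Ga Gb"
    by unfold_locales simp_all
  have axis: "\<exists>x y z. u = vG x \<and> algA_axis TYPE('f) x y z" if "u \<in> {vG Ga, vG Gb, vG Gc}"
    for u :: "'f ^ sym"
    using that loc by auto
  \<comment> \<open>The hull is the intersection of all such \<open>B\<close>.\<close>
  have "B = UNIV" if "subalgebra B" "{vG Ga, vG Gb, vG Gc} \<subseteq> B" for B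
    using algA_axis.subalgebra_eq_UNIV[OF loc(1) that(1)] that(2) by simp
  then have "subalgebra hull {vG Ga, vG Gb, vG Gc} = UNIV"
    unfolding hull_def by blast
  moreover have "algA_mult \<alpha> \<beta> \<gamma> \<psi> u u = u" if "u \<in> {vG Ga, vG Gb, vG Gc}" for u
    using that by (auto simp: algA_mult_axis prodGG_def)
  ultimately have "jordan_type_axial_algebra (*s) (algA_mult \<alpha> \<beta> \<gamma> \<psi>) (1/2) {vG Ga, vG Gb, vG Gc}"
    by unfold_locales
      (assumption | (drule axis, elim exE conjE, hypsubst, erule algA_axis.fusion)
        | (drule axis, elim exE conjE, hypsubst, rule exI, rule conjI,
            erule algA_axis.ad_min_poly, rule dvd_refl))+
  moreover have "\<forall>u\<in>{vG Ga, vG Gb, vG Gc}. primitive u"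
    by (intro ballI, drule axis, elim exE conjE, hypsubst, erule algA_axis.primitive_x)
  ultimately show ?thesis ..
qed

end
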